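(* Let $I,J\subset\mathbb{R}$ be open intervals, let $f:I\to\mathbb{R}$ and $h:J\to\mathbb{R}$ be smooth functions, and let $M^2$ be the translation surface parametrized by $\phi:I\times J\to\mathbb{R}^3$, $\phi(u,v)=(u,v,f(u)+h(v))$, with the Riemannian metric $g$ induced from $\mathbb{R}^3$. Then the coordinate vector fields $\frac{\partial}{\partial u}$ and $\frac{\partial}{\partial v}$ are harmonic sections on $(M^2,g)$ if and only if one of the following holds: 1. $f(u)=a_0u+a_1$ and $h(v)=b_0v+b_1$, where $a_0,a_1,b_0,b_1\in\mathbb{R}$ (in this case the translation surface is a plane); or 2. $$f(u)=\pm\left[c_0\sqrt{\alpha\exp\left(\tfrac{2u}{c_0}\right)-1}-c_0\arctan\left(\sqrt{\alpha\exp\left(\tfrac{2u}{c_0}\right)-1}\right)+c_1\right]\quad\text{and}\quad h(v)=k_0$$ for some constants $c_0\in\mathbb{R}\setminus\{0\}$, $k_0,c_1\in\mathbb{R}$ and $\alpha>0$ such that $\alpha\exp\left(\frac{2u}{c_0}\right)-1>0$.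
   Context: A smooth vector field $X$ on a Riemannian manifold $(M,g)$ with Levi-Civita connection $\nabla$ is called a harmonic section if its rough Laplacian vanishes: $\operatorname{Tr}_g\nabla^2X=\sum_i\left(\nabla_{e_i}\nabla_{e_i}X-\nabla_{\nabla_{e_i}e_i}X\right)=0$, where $\{e_i\}$ is any local orthonormal frame. The induced metric in the coordinates $(u,v)$ is $g=(1+f'^2)\,du^2+2f'h'\,du\,dv+(1+h'^2)\,dv^2$, and $\frac{\partial}{\partial u}=\phi_u=(1,0,f')$, $\frac{\partial}{\partial v}=\phi_v=(0,1,h')$ are the coordinate vector fields of the parametrization $\phi$. The identities for $f$ and $h$ and the inequality in item 2 are understood for all $u\in I$ and $v\in J$.
   Formalization: The "only if" as printed is false (e.g. f=0, h(v)=√(e^{2v}−1)−arctan√(e^{2v}−1) on v>0); a third alternative is added, the mirror image of item 2 with f constant and h of the exponential form. *)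

theory Defs
  imports "HOL-Analysis.Analysis"
begin

subsection \<open>Smooth maps on open sets\<close>

primrec Ck_on :: "nat \<Rightarrow> ('a::euclidean_space \<Rightarrow> 'b::real_normed_vector) \<Rightarrow> 'a set \<Rightarrow> bool" where
  "Ck_on 0 F U \<longleftrightarrow> continuous_on U F"
| "Ck_on (Suc k) F U \<longleftrightarrow>
     F differentiable_on U \<and> (\<forall>b\<in>Basis. Ck_on k (\<lambda>p. frechet_derivative F (at p) b) U)"

text \<open>Only meant for open \<open>U\<close>: there the derivative \<open>at p\<close> is that of the restriction of \<open>F\<close>
  to \<open>U\<close>, so nothing depends on the values of \<open>F\<close> outside \<open>U\<close>.\<close>

definition smooth_on :: "('a::euclidean_space \<Rightarrow> 'b::real_normed_vector) \<Rightarrow> 'a set \<Rightarrow> bool" where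
  "smooth_on F U \<longleftrightarrow> (\<forall>k. Ck_on k F U)"

definition partial :: "'n::finite \<Rightarrow> (real^'n \<Rightarrow> 'b::real_normed_vector) \<Rightarrow> real^'n \<Rightarrow> 'b" where
  "partial i F p = frechet_derivative F (at p) (axis i 1)"


subsection \<open>Riemannian geometry in a global chart\<close>

text \<open>A Riemannian metric on an open \<open>U\<close> is given by its Gram matrix \<open>g p\<close> in the coordinate
  frame, and a vector field \<open>X\<close> by its components: \<open>X p $ k\<close> is the coefficient of
  \<open>\<partial>/\<partial>x\<^sub>k\<close> at \<open>p\<close>.\<close>

definition coordinate_field :: "'n::finite \<Rightarrow> real^'n \<Rightarrow> real^'n" where
  "coordinate_field i = (\<lambda>p. axis i 1)"

definition induced_metric :: "(real^'n::finite \<Rightarrow> real^'m::finite) \<Rightarrow> real^'n \<Rightarrow> real^'n^'n" where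
  "induced_metric \<phi> p = (\<chi> i j. partial i \<phi> p \<bullet> partial j \<phi> p)"

definition christoffel ::
    "(real^'n::finite \<Rightarrow> real^'n^'n) \<Rightarrow> 'n \<Rightarrow> 'n \<Rightarrow> 'n \<Rightarrow> real^'n \<Rightarrow> real" where
  "christoffel g k i j p =
     (\<Sum>l\<in>UNIV. matrix_inv (g p) $ k $ l *
        (partial i (\<lambda>q. g q $ j $ l) p + partial j (\<lambda>q. g q $ i $ l) p
          - partial l (\<lambda>q. g q $ i $ j) p)) / 2"

text \<open>\<open>levi_civita g Y X\<close> is the field \<open>\<nabla>\<^sub>Y X\<close>.\<close>

definition levi_civita ::
    "(real^'n::finite \<Rightarrow> real^'n^'n) \<Rightarrow> (real^'n \<Rightarrow> real^'n) \<Rightarrow> (real^'n \<Rightarrow> real^'n)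
       \<Rightarrow> real^'n \<Rightarrow> real^'n" where
  "levi_civita g Y X p =
     (\<chi> k. (\<Sum>i\<in>UNIV. Y p $ i * partial i (\<lambda>q. X q $ k) p)
         + (\<Sum>i\<in>UNIV. \<Sum>j\<in>UNIV. christoffel g k i j p * Y p $ i * X p $ j))"

definition orthonormal_frame_on ::
    "(real^'n::finite) set \<Rightarrow> (real^'n \<Rightarrow> real^'n^'n) \<Rightarrow> ('n \<Rightarrow> real^'n \<Rightarrow> real^'n) \<Rightarrow> bool" where
  "orthonormal_frame_on V g e \<longleftrightarrow>
     (\<forall>i. smooth_on (e i) V) \<and>
     (\<forall>p\<in>V. \<forall>i j. e i p \<bullet> (g p *v e j p) = (if i = j then 1 else 0))"

definition rough_laplacian ::
    "(real^'n::finite \<Rightarrow> real^'n^'n) \<Rightarrow> ('n \<Rightarrow> real^'n \<Rightarrow> real^'n) \<Rightarrow> (real^'n \<Rightarrow> real^'n)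
       \<Rightarrow> real^'n \<Rightarrow> real^'n" where
  "rough_laplacian g e X p =
     (\<Sum>i\<in>UNIV. levi_civita g (e i) (levi_civita g (e i) X) p
             - levi_civita g (levi_civita g (e i) (e i)) X p)"

text \<open>Every point of \<open>U\<close> has a neighbourhood carrying a smooth orthonormal frame (Gram-Schmidt),
  so quantifying over all local frames is not vacuous.\<close>

definition harmonic_section ::
    "(real^'n::finite) set \<Rightarrow> (real^'n \<Rightarrow> real^'n^'n) \<Rightarrow> (real^'n \<Rightarrow> real^'n) \<Rightarrow> bool" where
  "harmonic_section U g X \<longleftrightarrow>
     smooth_on X U \<and>
     (\<forall>V e. open V \<and> V \<subseteq> U \<and> orthonormal_frame_on V g e \<longrightarrow>
        (\<forall>p\<in>V. rough_laplacian g e X p = 0))"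


subsection \<open>Translation surfaces\<close>

definition coordinate_rectangle :: "real set \<Rightarrow> real set \<Rightarrow> (real^2) set" where
  "coordinate_rectangle I J = {p. p$1 \<in> I \<and> p$2 \<in> J}"

definition translation_param :: "(real \<Rightarrow> real) \<Rightarrow> (real \<Rightarrow> real) \<Rightarrow> real^2 \<Rightarrow> real^3" where
  "translation_param f h p = vector [p$1, p$2, f (p$1) + h (p$2)]"

definition affine_function_on :: "real set \<Rightarrow> (real \<Rightarrow> real) \<Rightarrow> bool" where
  "affine_function_on I f \<longleftrightarrow> (\<exists>a0 a1. \<forall>u\<in>I. f u = a0 * u + a1)"

definition constant_function_on :: "real set \<Rightarrow> (real \<Rightarrow> real) \<Rightarrow> bool" where
  "constant_function_on I f \<longleftrightarrow> (\<exists>k0. \<forall>u\<in>I. f u = k0)"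

definition exponential_profile_on :: "real set \<Rightarrow> (real \<Rightarrow> real) \<Rightarrow> bool" where
  "exponential_profile_on I f \<longleftrightarrow>
     (\<exists>c0 c1 \<alpha> \<sigma>. c0 \<noteq> 0 \<and> \<alpha> > 0 \<and> \<sigma> \<in> {1, -1} \<and>
        (\<forall>u\<in>I. \<alpha> * exp (2 * u / c0) - 1 > 0 \<and>
           f u = \<sigma> * (c0 * sqrt (\<alpha> * exp (2 * u / c0) - 1)
                    - c0 * arctan (sqrt (\<alpha> * exp (2 * u / c0) - 1)) + c1)))"

text \<open>\<open>S\<close> is an open piece of an affine plane.\<close>

definition planar_surface :: "(real^3) set \<Rightarrow> bool" where
  "planar_surface S \<longleftrightarrow> (\<exists>P. affine P \<and> aff_dim P = 2 \<and> openin (top_of_set P) S)"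

text \<open>Exchanging \<open>(u, f, I)\<close> with \<open>(v, h, J)\<close> is induced by an isometry of the ambient space and
  swaps the two coordinate fields. Hence both fields are harmonic for \<open>(f, h)\<close> iff they are
  for \<open>(h, f)\<close>, and in the non-planar case the exponential profile can be on either factor, the
  other factor being constant.\<close>

end

theory Submission
  imports Defs
begin

text \<open>Write \<open>p = f'\<close>, \<open>q = h'\<close> and \<open>W = 1 + p\<^sup>2 + q\<^sup>2\<close>. The only nonzero
  Christoffel symbols are \<open>\<Gamma>\<^sup>k\<^sub>a\<^sub>a\<close>, so \<open>\<nabla>\<^sub>Y \<partial>\<^sub>a\<close> is \<open>Y\<^sup>a\<close> times a fixed field and the rough
  Laplacian of \<open>\<partial>\<^sub>a\<close> is an explicit rational function of the derivatives of \<open>f\<close> and \<open>h\<close>. Where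
  \<open>p q \<noteq> 0\<close>, eliminating \<open>p''\<close> from the two components for \<open>\<partial>\<^sub>u\<close> leaves
  \<open>p' ((1 + q\<^sup>2) p' + p\<^sup>2 q') = 0\<close>; together with its mirror image this forces \<open>p' = q' = 0\<close>,
  because \<open>(1 + p\<^sup>2) (1 + q\<^sup>2) - p\<^sup>2 q\<^sup>2 = W \<noteq> 0\<close>. Hence either both profiles are affine or one of
  them is constant, and if \<open>q = 0\<close> the remaining equation says that \<open>p p' / (1 + p\<^sup>2)\<close> is
  constant, i.e. \<open>1 + p\<^sup>2 = \<alpha> exp (2 u / c\<^sub>0)\<close>, which integrates to the stated formula.\<close>

subsection \<open>Calculus of smooth maps\<close>

text \<open>Derivatives at a point of an open set see only nearby values, so the agreement of
  \<open>F\<close> and \<open>G\<close> passes to all iterated derivatives.\<close>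

lemma Ck_on_cong:
  assumes "open U" "\<And>x. x \<in> U \<Longrightarrow> F x = G x"
  shows "Ck_on k F U \<longleftrightarrow> Ck_on k G U"
  using assms(2)
proof (induction k arbitrary: F G)
  case 0
  then show ?case by (simp cong: continuous_on_cong)
next
  case (Suc k)
  have iff: "(F has_derivative D) (at x) \<longleftrightarrow> (G has_derivative D) (at x)" if "x \<in> U" for x D
    using has_derivative_transform_within_open[OF _ \<open>open U\<close> that] Suc.prems by metis
  then have der: "frechet_derivative F (at x) = frechet_derivative G (at x)" if "x \<in> U" for x
    using that unfolding frechet_derivative_def by simp
  have "F differentiable_on U \<longleftrightarrow> G differentiable_on U"
    using iff by (simp add: differentiable_on_eq_differentiable_at[OF \<open>open U\<close>] differentiable_def)
  moreover have "Ck_on k (\<lambda>x. frechet_derivative F (at x) b) U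
      \<longleftrightarrow> Ck_on k (\<lambda>x. frechet_derivative G (at x) b) U" for b
    by (rule Suc.IH) (simp add: der)
  ultimately show ?case by simp
qed

text \<open>Allows any explicit derivative \<open>D\<close> in place of
  \<open>frechet_derivative\<close>, so the closure properties below follow by induction on
  \<open>k\<close> from the usual differentiation rules.\<close>

lemma Ck_on_SucI:
  assumes "open U"
    and "\<And>x. x \<in> U \<Longrightarrow> (F has_derivative D x) (at x)"
    and "\<And>b. b \<in> Basis \<Longrightarrow> Ck_on k (\<lambda>x. D x b) U"
  shows "Ck_on (Suc k) F U"
proof -
  have "Ck_on k (\<lambda>x. frechet_derivative F (at x) b) U" if "b \<in> Basis" for b
    using assms(3)[OF that] assms(2) Ck_on_cong[OF \<open>open U\<close>] frechet_derivative_at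
    by (smt (verit, best))
  moreover have "F differentiable_on U"
    using assms(2) by (meson differentiable_at_imp_differentiable_on differentiable_def)
  ultimately show ?thesis by simp
qed

lemma Ck_on_SucD:
  assumes "open U" "Ck_on (Suc k) F U" "x \<in> U"
  shows "(F has_derivative frechet_derivative F (at x)) (at x)"
  using assms by (metis Ck_on.simps(2) differentiable_on_eq_differentiable_at frechet_derivative_works)

lemma Ck_on_Suc_imp_Ck_on:
  assumes "Ck_on (Suc k) F U"
  shows "Ck_on k F U"
  using assms
proof (induction k arbitrary: F)
  case 0
  then show ?case by (simp add: differentiable_imp_continuous_on)
next
  case (Suc k)
  then show ?case by (metis Ck_on.simps(2))
qed

lemma Ck_on_const: "Ck_on k (\<lambda>x. c) U"
  by (induction k arbitrary: c) simp_all

lemma Ck_on_bounded_linear: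
  assumes "bounded_linear L" "open U" "Ck_on k F U"
  shows "Ck_on k (\<lambda>x. L (F x)) U"
  using assms(3)
proof (induction k arbitrary: F)
  case 0
  then show ?case using bounded_linear.continuous_on[OF assms(1)] by simp
next
  case (Suc k)
  show ?case
  proof (rule Ck_on_SucI[OF \<open>open U\<close>])
    show "((\<lambda>x. L (F x)) has_derivative (\<lambda>v. L (frechet_derivative F (at x) v))) (at x)"
      if "x \<in> U" for x
      by (rule bounded_linear.has_derivative[OF assms(1) Ck_on_SucD[OF \<open>open U\<close> Suc.prems that]])
  qed (use Suc in auto)
qed

lemma Ck_on_add:
  assumes "open U" "Ck_on k F U" "Ck_on k G U"
  shows "Ck_on k (\<lambda>x. F x + G x) U"
  using assms(2,3)
proof (induction k arbitrary: F G)
  case 0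
  then show ?case by (simp add: continuous_on_add)
next
  case (Suc k)
  show ?case
  proof (rule Ck_on_SucI[OF \<open>open U\<close>])
    show "((\<lambda>x. F x + G x) has_derivative
        (\<lambda>v. frechet_derivative F (at x) v + frechet_derivative G (at x) v)) (at x)"
      if "x \<in> U" for x
      using Suc.prems that by (intro has_derivative_add Ck_on_SucD[OF \<open>open U\<close>])
  qed (use Suc in auto)
qed

lemma Ck_on_mult:
  fixes F G :: "'a::euclidean_space \<Rightarrow> real"
  assumes "open U" "Ck_on k F U" "Ck_on k G U"
  shows "Ck_on k (\<lambda>x. F x * G x) U"
  using assms(2,3)
proof (induction k arbitrary: F G)
  case 0
  then show ?case by (simp add: continuous_on_mult)
next
  case (Suc k)
  show ?case
  proof (rule Ck_on_SucI[OF \<open>open U\<close>])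
    show "((\<lambda>x. F x * G x) has_derivative
        (\<lambda>v. F x * frechet_derivative G (at x) v + frechet_derivative F (at x) v * G x)) (at x)"
      if "x \<in> U" for x
      using Suc.prems that by (intro has_derivative_mult Ck_on_SucD[OF \<open>open U\<close>])
    show "Ck_on k (\<lambda>x. F x * frechet_derivative G (at x) b + frechet_derivative F (at x) b * G x) U"
      if "b \<in> Basis" for b
    proof (intro Ck_on_add \<open>open U\<close> Suc.IH)
      \<comment> \<open>The product rule also leaves \<open>F\<close> and \<open>G\<close>
        undifferentiated, so their order has to be lowered from \<open>Suc k\<close> to
        \<open>k\<close>.\<close>
      show "Ck_on k F U" "Ck_on k G U"
        using Suc.prems Ck_on_Suc_imp_Ck_on by blast+
    qed (use Suc.prems that in auto)
  qed
qed

text \<open>The derivative of \<open>1 / F\<close> is a polynomial in \<open>1 / F\<close> and the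
  derivative of \<open>F\<close>, so the same function at order \<open>k\<close> gives order
  \<open>Suc k\<close>. The square root below works likewise.\<close>

lemma Ck_on_inverse:
  fixes F :: "'a::euclidean_space \<Rightarrow> real"
  assumes "open U" "Ck_on k F U" "\<And>x. x \<in> U \<Longrightarrow> F x \<noteq> 0"
  shows "Ck_on k (\<lambda>x. inverse (F x)) U"
  using assms(2)
proof (induction k)
  case 0
  then show ?case using assms(3) by (simp add: continuous_on_inverse)
next
  case (Suc k)
  have IH: "Ck_on k (\<lambda>x. inverse (F x)) U"
    using Suc Ck_on_Suc_imp_Ck_on by blast
  show ?case
  proof (rule Ck_on_SucI[OF \<open>open U\<close>])
    show "((\<lambda>x. inverse (F x)) has_derivative
        (\<lambda>v. (- 1) * (inverse (F x) * frechet_derivative F (at x) v * inverse (F x)))) (at x)"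
      if "x \<in> U" for x
      using Deriv.has_derivative_inverse[OF assms(3)[OF that] Ck_on_SucD[OF \<open>open U\<close> Suc.prems that]]
      by simp
    show "Ck_on k (\<lambda>x. (- 1) * (inverse (F x) * frechet_derivative F (at x) b * inverse (F x))) U"
      if "b \<in> Basis" for b
      using Suc.prems that by (intro Ck_on_mult Ck_on_const \<open>open U\<close> IH) auto
  qed
qed

lemma Ck_on_sqrt:
  fixes F :: "'a::euclidean_space \<Rightarrow> real"
  assumes "open U" "Ck_on k F U" "\<And>x. x \<in> U \<Longrightarrow> F x > 0"
  shows "Ck_on k (\<lambda>x. sqrt (F x)) U"
  using assms(2)
proof (induction k)
  case 0
  then show ?case by (simp add: continuous_on_real_sqrt)
next
  case (Suc k)
  have IH: "Ck_on k (\<lambda>x. sqrt (F x)) U"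
    using Suc Ck_on_Suc_imp_Ck_on by blast
  show ?case
  proof (rule Ck_on_SucI[OF \<open>open U\<close>])
    show "((\<lambda>x. sqrt (F x)) has_derivative
        (\<lambda>v. frechet_derivative F (at x) v * inverse (2 * sqrt (F x)))) (at x)"
      if "x \<in> U" for x
    proof -
      have "((\<lambda>x. sqrt (F x)) has_derivative
          (\<lambda>v. frechet_derivative F (at x) v * (inverse (sqrt (F x)) / 2))) (at x)"
        by (rule DERIV_compose_FDERIV[where f = sqrt, OF DERIV_real_sqrt[OF assms(3)[OF that]]
              Ck_on_SucD[OF \<open>open U\<close> Suc.prems that]])
      then show ?thesis by (simp add: field_simps)
    qed
    show "Ck_on k (\<lambda>x. frechet_derivative F (at x) b * inverse (2 * sqrt (F x))) U"
      if "b \<in> Basis" for b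
      using Suc.prems that assms(3)
      by (intro Ck_on_mult Ck_on_inverse Ck_on_const \<open>open U\<close> IH) force+
  qed
qed

lemma smooth_on_deriv:
  fixes f :: "real \<Rightarrow> real"
  assumes "open I" "smooth_on f I"
  shows "smooth_on (deriv f) I"
    and "\<And>x. x \<in> I \<Longrightarrow> (f has_field_derivative deriv f x) (at x)"
proof -
  have *: "(f has_derivative frechet_derivative f (at x)) (at x)" if "x \<in> I" for x
    using assms that Ck_on_SucD unfolding smooth_on_def by blast
  show **: "(f has_field_derivative deriv f x) (at x)" if "x \<in> I" for x
    using *[OF that] DERIV_deriv_iff_real_differentiable differentiable_def by blast
  have "deriv f x = frechet_derivative f (at x) 1" if "x \<in> I" for x
    using has_derivative_unique[OF *[OF that] **[OF that, unfolded has_field_derivative_def]]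
    by simp
  moreover have "Ck_on k (\<lambda>x. frechet_derivative f (at x) 1) I" for k
    using assms(2) unfolding smooth_on_def by (metis Ck_on.simps(2) Basis_real_def singletonI)
  ultimately show "smooth_on (deriv f) I"
    unfolding smooth_on_def using Ck_on_cong[OF assms(1)] by (smt (verit, best))
qed

text \<open>Full smoothness of \<open>f\<close> is assumed, not just order \<open>k\<close>, because
  it passes to \<open>deriv f\<close>, to which the induction hypothesis is then applied.\<close>

lemma Ck_on_compose_nth:
  fixes f :: "real \<Rightarrow> real" and U :: "(real^'n::finite) set"
  assumes "open U" "open I" "smooth_on f I" "\<And>x. x \<in> U \<Longrightarrow> x $ a \<in> I"
  shows "Ck_on k (\<lambda>x. f (x $ a)) U"
  using assms(3)
proof (induction k arbitrary: f)
  case 0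
  then have "continuous_on I f" unfolding smooth_on_def by (metis Ck_on.simps(1))
  then show ?case
    using assms(4) by (auto intro!: continuous_on_compose2[of I f] continuous_intros)
next
  case (Suc k)
  show ?case
  proof (rule Ck_on_SucI[OF \<open>open U\<close>])
    show "((\<lambda>x. f (x $ a)) has_derivative (\<lambda>v. v $ a * deriv f (x $ a))) (at x)" if "x \<in> U" for x
      using DERIV_compose_FDERIV[where f = f and g = "\<lambda>x. x $ a", OF smooth_on_deriv(2)[OF \<open>open I\<close> Suc.prems assms(4)[OF that]]]
        bounded_linear_imp_has_derivative[OF bounded_linear_vec_nth] by blast
    show "Ck_on k (\<lambda>x. b $ a * deriv f (x $ a)) U" for b :: "real^'n"
      by (intro Ck_on_mult Ck_on_const Suc.IH smooth_on_deriv(1) \<open>open U\<close> \<open>open I\<close> Suc.prems)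
  qed
qed

subsection \<open>The rough Laplacian of the coordinate fields\<close>

lemma partial_eqI:
  assumes "(F has_derivative F') (at p)"
  shows "partial i F p = F' (axis i 1)"
  using assms frechet_derivative_at[OF assms] by (simp add: partial_def)

lemma partial_cong:
  assumes "open U" "p \<in> U" "\<And>x. x \<in> U \<Longrightarrow> F x = G x"
  shows "partial i F p = partial i G p"
proof -
  have "(F has_derivative D) (at p) \<longleftrightarrow> (G has_derivative D) (at p)" for D
    using has_derivative_transform_within_open[OF _ assms(1,2)] assms(3) by metis
  then show ?thesis unfolding partial_def frechet_derivative_def by simp
qed

lemma partial_mult:
  fixes F G :: "real^'n::finite \<Rightarrow> real"
  assumes "F differentiable (at p)" "G differentiable (at p)"
  shows "partial i (\<lambda>x. F x * G x) p = partial i F p * G p + F p * partial i G p"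
  using partial_eqI[OF has_derivative_mult[OF assms[unfolded frechet_derivative_works]]]
  by (simp add: partial_def)

lemma smooth_on_differentiable:
  assumes "open U" "smooth_on F U" "x \<in> U"
  shows "F differentiable (at x)"
  using assms Ck_on_SucD unfolding smooth_on_def differentiable_def by blast

lemma matrix_inv_eqI:
  fixes A B :: "real^'n::finite^'n"
  assumes "A ** B = mat 1"
  shows "matrix_inv A = B"
proof -
  have "\<exists>A'. A ** A' = mat 1 \<and> A' ** A = mat 1"
    using assms matrix_left_right_inverse by blast
  then have "A ** matrix_inv A = mat 1 \<and> matrix_inv A ** A = mat 1"
    unfolding matrix_inv_def by (rule someI_ex)
  then show ?thesis
    by (metis assms matrix_mul_assoc matrix_mul_lid matrix_mul_rid)
qed

text \<open>With the frame vectors as rows of \<open>M\<close>, orthonormality reads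
  \<open>M g M\<^sup>T = 1\<close>, hence \<open>M\<^sup>T M\<close> is the inverse of
  \<open>g\<close>. This makes the trace independent of the frame.\<close>

lemma orthonormal_frame_on_sum:
  assumes "orthonormal_frame_on V g e" "p \<in> V"
  shows "(\<Sum>m\<in>UNIV. e m p $ i * e m p $ j) = matrix_inv (g p) $ i $ j"
proof -
  define M where "M = (\<chi> m. e m p)"
  have "M ** (g p ** transpose M) = mat 1"
  proof (simp add: vec_eq_iff, intro allI)
    fix i j
    have "(M ** (g p ** transpose M)) $ i $ j = e i p \<bullet> (g p *v e j p)"
      by (simp add: M_def matrix_matrix_mult_def matrix_vector_mult_def transpose_def inner_vec_def)
    then show "(M ** (g p ** transpose M)) $ i $ j = mat 1 $ i $ j"
      using assms by (simp add: orthonormal_frame_on_def mat_def)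
  qed
  \<comment> \<open>For square matrices a one-sided inverse is two-sided, so \<open>M\<close> can
    move from the left end of the product to the right end.\<close>
  then have "g p ** (transpose M ** M) = mat 1"
    using matrix_left_right_inverse[of M] by (metis matrix_mul_assoc)
  from matrix_inv_eqI[OF this] show ?thesis
    by (simp add: M_def matrix_matrix_mult_def transpose_def)
qed

text \<open>The metric is that of the graph of the sum of the \<open>P a (x $ a)\<close> over the
  product of the sets \<open>D a\<close>. A general index type treats all coordinate directions
  alike.\<close>

locale translation_metric =
  fixes P :: "'n::finite \<Rightarrow> real \<Rightarrow> real" and D :: "'n \<Rightarrow> real set"
    and g :: "real^'n \<Rightarrow> real^'n^'n" and U :: "(real^'n) set"
  assumes open_D: "open (D a)"
    and smooth_P: "smooth_on (P a) (D a)"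
    and mem_U: "x \<in> U \<longleftrightarrow> (\<forall>a. x $ a \<in> D a)"
    and metric: "x \<in> U \<Longrightarrow>
      g x $ i $ j = (if i = j then 1 else 0) + deriv (P i) (x $ i) * deriv (P j) (x $ j)"
begin

definition s :: "nat \<Rightarrow> 'n \<Rightarrow> real^'n \<Rightarrow> real" where
  "s n a x = (deriv ^^ n) (P a) (x $ a)"

text \<open>On \<open>U\<close> this is the determinant of the Gram matrix.\<close>

definition W :: "real^'n \<Rightarrow> real" where
  "W x = 1 + (\<Sum>a\<in>UNIV. (s 1 a x)\<^sup>2)"

text \<open>The Sherman-Morrison formula for the inverse of a rank-one perturbation of the
  identity.\<close>

definition G :: "'n \<Rightarrow> 'n \<Rightarrow> real^'n \<Rightarrow> real" where
  "G i j x = (if i = j then 1 else 0) - s 1 i x * s 1 j x / W x"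

text \<open>In these coordinates \<open>\<Gamma>\<^sup>k\<^sub>i\<^sub>j\<close> vanishes for \<open>i \<noteq> j\<close>, and \<open>\<Gamma> a k\<close> is \<open>\<Gamma>\<^sup>k\<^sub>a\<^sub>a\<close>,
  which is also the \<open>k\<close>-th component of the covariant derivative of \<open>\<partial>\<^sub>a\<close> along \<open>\<partial>\<^sub>a\<close>.\<close>

definition \<Gamma> :: "'n \<Rightarrow> 'n \<Rightarrow> real^'n \<Rightarrow> real" where
  "\<Gamma> a k x = s 2 a x * s 1 k x / W x"

text \<open>The derivative of \<open>\<Gamma> a k\<close> in direction \<open>i\<close> by the
  quotient rule; the last term comes from differentiating \<open>W\<close>.\<close>

definition d\<Gamma> :: "'n \<Rightarrow> 'n \<Rightarrow> 'n \<Rightarrow> real^'n \<Rightarrow> real" where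
  "d\<Gamma> i a k x = ((if i = a then s 3 a x * s 1 k x else 0) + (if i = k then s 2 a x * s 2 k x else 0)) / W x
     - 2 * s 2 a x * s 1 k x * s 1 i x * s 2 i x / (W x)\<^sup>2"

text \<open>Component \<open>k\<close> of the rough Laplacian of the \<open>a\<close>-th coordinate
  field, with the trace over a frame already contracted to the inverse metric.\<close>

definition L :: "'n \<Rightarrow> 'n \<Rightarrow> real^'n \<Rightarrow> real" where
  "L a k x = (\<Sum>i\<in>UNIV. G i a x * (d\<Gamma> i a k x + \<Gamma> a i x * \<Gamma> i k x) - G i i x * \<Gamma> i a x * \<Gamma> a k x)"

lemma W_pos: "W x > 0"
  unfolding W_def by (smt (verit) sum_nonneg zero_le_power2)

lemma open_U: "open U"
proof -
  have "U = (\<Inter>a. (\<lambda>x. x $ a) -` D a)"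
    using mem_U by auto
  then show ?thesis
    by (simp add: open_INT open_D open_vimage_vec_nth)
qed

lemma smooth_deriv_P: "smooth_on ((deriv ^^ n) (P a)) (D a)"
  by (induction n) (auto simp: smooth_P smooth_on_deriv(1)[OF open_D])

lemma has_derivative_s:
  assumes "x \<in> U"
  shows "(s n a has_derivative (\<lambda>v. v $ a * s (Suc n) a x)) (at x)"
proof -
  have "x $ a \<in> D a" using assms mem_U by blast
  from DERIV_compose_FDERIV[where g = "\<lambda>x. x $ a",
      OF smooth_on_deriv(2)[OF open_D smooth_deriv_P this]
        bounded_linear_imp_has_derivative[OF bounded_linear_vec_nth]]
  show ?thesis by (simp add: s_def[abs_def])
qed

lemma has_derivative_W:
  assumes "x \<in> U"
  shows "(W has_derivative (\<lambda>v. \<Sum>a\<in>UNIV. 2 * s 1 a x * s 2 a x * v $ a)) (at x)"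
  unfolding W_def[abs_def] power2_eq_square
  by (auto intro!: derivative_eq_intros has_derivative_s[OF assms] sum.cong
      simp: eval_nat_numeral ac_simps)

lemma partial_s: "x \<in> U \<Longrightarrow> partial i (s n a) x = (if i = a then s (Suc n) a x else 0)"
  by (auto simp: partial_eqI[OF has_derivative_s] axis_def)

lemma differentiable_\<Gamma>: "x \<in> U \<Longrightarrow> \<Gamma> a k differentiable (at x)"
  and partial_\<Gamma>: "x \<in> U \<Longrightarrow> partial i (\<Gamma> a k) x = d\<Gamma> i a k x"
proof -
  assume x: "x \<in> U"
  note der = has_derivative_divide[OF has_derivative_mult[OF has_derivative_s[OF x, of 2 a]
        has_derivative_s[OF x, of 1 k]] has_derivative_W[OF x] less_imp_neq[OF W_pos, symmetric]]
  show "\<Gamma> a k differentiable (at x)"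
    unfolding \<Gamma>_def[abs_def] differentiable_def using der by blast
  have "(\<Sum>j\<in>UNIV. 2 * s 1 j x * s 2 j x * axis i 1 $ j) = 2 * s 1 i x * s 2 i x"
    by (simp add: axis_def if_distrib cong: if_cong)
  then show "partial i (\<Gamma> a k) x = d\<Gamma> i a k x"
    unfolding \<Gamma>_def[abs_def] partial_eqI[OF der] d\<Gamma>_def
    by (simp add: axis_def eval_nat_numeral divide_inverse algebra_simps)
qed

text \<open>The gradient vector is an eigenvector of the inverse metric with eigenvalue
  \<open>1 / W\<close>, because its squared length is \<open>W - 1\<close>.\<close>

lemma sum_G_s: "(\<Sum>l\<in>UNIV. G k l x * s 1 l x) = s 1 k x / W x"
proof -
  have "(\<Sum>l\<in>UNIV. G k l x * s 1 l x)
      = (\<Sum>l\<in>UNIV. (if k = l then s 1 l x else 0) - s 1 k x / W x * (s 1 l x)\<^sup>2)"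
    by (rule sum.cong) (auto simp: G_def field_simps power2_eq_square)
  also have "\<dots> = s 1 k x - s 1 k x / W x * (\<Sum>l\<in>UNIV. (s 1 l x)\<^sup>2)"
    by (simp add: sum_subtractf sum_distrib_left)
  also have "(\<Sum>l\<in>UNIV. (s 1 l x)\<^sup>2) = W x - 1"
    by (simp add: W_def)
  also have "s 1 k x - s 1 k x / W x * (W x - 1) = s 1 k x / W x"
    using W_pos[of x] by (simp add: field_simps)
  finally show ?thesis .
qed

lemma metric_s:
  assumes "x \<in> U"
  shows "g x $ i $ j = (if i = j then 1 else 0) + s 1 i x * s 1 j x"
  using metric[OF assms] by (simp add: s_def)

lemma matrix_inv_metric:
  assumes "x \<in> U"
  shows "matrix_inv (g x) $ i $ j = G i j x"
proof -
  have "(\<Sum>l\<in>UNIV. g x $ i $ l * G l j x) = (if i = j then 1 else 0)" for i j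
  proof -
    have "(\<Sum>l\<in>UNIV. g x $ i $ l * G l j x)
        = (\<Sum>l\<in>UNIV. (if i = l then G l j x else 0) + s 1 i x * (G j l x * s 1 l x))"
      \<comment> \<open>The symmetry of \<open>G\<close> turns \<open>G l j\<close> into
        \<open>G j l\<close>, the form that \<open>sum_G_s\<close> contracts.\<close>
      by (rule sum.cong) (auto simp: metric_s[OF assms] G_def algebra_simps)
    also have "\<dots> = G i j x + s 1 i x * (s 1 j x / W x)"
      by (simp add: sum.distrib sum_distrib_left[symmetric] sum_G_s del: One_nat_def)
    finally show ?thesis by (simp add: G_def)
  qed
  then have "g x ** (\<chi> i j. G i j x) = mat 1"
    by (simp add: vec_eq_iff matrix_matrix_mult_def mat_def)
  from matrix_inv_eqI[OF this] show ?thesis by simp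
qed

lemma partial_metric:
  assumes "x \<in> U"
  shows "partial l (\<lambda>q. g q $ i $ j) x
    = (if l = i then s 2 i x * s 1 j x else 0) + (if l = j then s 1 i x * s 2 j x else 0)"
proof -
  have "partial l (\<lambda>q. g q $ i $ j) x
      = partial l (\<lambda>q. (if i = j then 1 else 0) + s 1 i q * s 1 j q) x"
    by (rule partial_cong[OF open_U assms metric_s])
  also have "\<dots> = (if l = i then s 2 i x * s 1 j x else 0) + (if l = j then s 1 i x * s 2 j x else 0)"
    by (subst partial_eqI[OF has_derivative_add[OF has_derivative_const
            has_derivative_mult[OF has_derivative_s has_derivative_s]]])
      (auto simp: assms axis_def eval_nat_numeral)
  finally show ?thesis .
qed

text \<open>For \<open>i \<noteq> j\<close> the three derivatives of the metric cancel, since each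
  profile depends on one coordinate only. For \<open>i = j\<close> they add up to
  \<open>2 * s 2 i x * s 1 l x\<close>, which \<open>sum_G_s\<close> contracts.\<close>

lemma christoffel_eq:
  assumes "x \<in> U"
  shows "christoffel g k i j x = (if i = j then \<Gamma> i k x else 0)"
proof -
  have "christoffel g k i j x
      = (\<Sum>l\<in>UNIV. (if i = j then s 2 i x else 0) * (G k l x * s 1 l x))"
    unfolding christoffel_def sum_divide_distrib
    by (rule sum.cong) (auto simp: partial_metric[OF assms] matrix_inv_metric[OF assms])
  then show ?thesis
    by (simp add: sum_distrib_left[symmetric] sum_G_s \<Gamma>_def del: One_nat_def)
qed

lemma levi_civita_eq:
  assumes "x \<in> U"
  shows "levi_civita g Y X x $ k
    = (\<Sum>i\<in>UNIV. Y x $ i * (partial i (\<lambda>q. X q $ k) x + \<Gamma> i k x * X x $ i))"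
proof -
  have "(\<Sum>j\<in>UNIV. christoffel g k i j x * Y x $ i * X x $ j)
      = (\<Sum>j\<in>UNIV. if i = j then Y x $ i * (\<Gamma> i k x * X x $ i) else 0)" for i
    by (rule sum.cong) (auto simp: christoffel_eq[OF assms])
  then show ?thesis
    by (simp add: levi_civita_def sum.distrib distrib_left)
qed

lemma levi_civita_coordinate_field:
  assumes "x \<in> U"
  shows "levi_civita g Y (coordinate_field a) x $ k = Y x $ a * \<Gamma> a k x"
proof -
  have "partial i (\<lambda>q. coordinate_field a q $ k) x = 0" for i
    unfolding coordinate_field_def by (simp add: partial_eqI[OF has_derivative_const])
  then show ?thesis
    by (simp add: levi_civita_eq[OF assms] coordinate_field_def axis_def
        if_distrib[of "\<lambda>z. _ * z"] cong: if_cong)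
qed

text \<open>The derivatives of \<open>Y\<close> enter only through the derivative of
  \<open>Y\<^sup>a\<close> along \<open>Y\<close>, which occurs in both terms and cancels. The
  result is quadratic in the value of \<open>Y\<close> at \<open>p\<close>.\<close>

lemma second_covariant_derivative:
  assumes "p \<in> U" and diff: "(\<lambda>x. Y x $ a) differentiable (at p)"
  shows "(levi_civita g Y (levi_civita g Y (coordinate_field a)) p
           - levi_civita g (levi_civita g Y Y) (coordinate_field a) p) $ k
    = (\<Sum>i\<in>UNIV. Y p $ i * Y p $ a * (d\<Gamma> i a k p + \<Gamma> a i p * \<Gamma> i k p)
        - Y p $ i * Y p $ i * \<Gamma> i a p * \<Gamma> a k p)"
proof -
  have "partial i (\<lambda>q. levi_civita g Y (coordinate_field a) q $ k) p
      = partial i (\<lambda>x. Y x $ a) p * \<Gamma> a k p + Y p $ a * d\<Gamma> i a k p" for i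
    using partial_cong[OF open_U assms(1) levi_civita_coordinate_field]
      partial_mult[OF diff differentiable_\<Gamma>[OF assms(1)]] partial_\<Gamma>[OF assms(1)] by simp
  then show ?thesis
    by (simp add: levi_civita_coordinate_field[OF assms(1)]
        levi_civita_eq[OF assms(1), of Y "levi_civita g Y (coordinate_field a)"]
        levi_civita_eq[OF assms(1), of Y Y]
        sum_distrib_left sum_distrib_right sum_subtractf sum.distrib algebra_simps)
qed

lemma rough_laplacian_coordinate_field:
  assumes "open V" "V \<subseteq> U" "orthonormal_frame_on V g e" "p \<in> V"
  shows "rough_laplacian g e (coordinate_field a) p $ k = L a k p"
proof -
  have p: "p \<in> U" using assms by blast
  have diff: "(\<lambda>x. e m x $ a) differentiable (at p)" for m
    using assms smooth_on_differentiable[of V "e m" p]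
      bounded_linear.has_derivative[OF bounded_linear_vec_nth]
    unfolding orthonormal_frame_on_def differentiable_def by blast
  have "rough_laplacian g e (coordinate_field a) p $ k
    = (\<Sum>m\<in>UNIV. \<Sum>i\<in>UNIV. e m p $ i * e m p $ a * (d\<Gamma> i a k p + \<Gamma> a i p * \<Gamma> i k p)
        - e m p $ i * e m p $ i * \<Gamma> i a p * \<Gamma> a k p)"
    unfolding rough_laplacian_def sum_component second_covariant_derivative[OF p diff] ..
  also have "\<dots> = (\<Sum>i\<in>UNIV. (\<Sum>m\<in>UNIV. e m p $ i * e m p $ a) * (d\<Gamma> i a k p + \<Gamma> a i p * \<Gamma> i k p)
        - (\<Sum>m\<in>UNIV. e m p $ i * e m p $ i) * \<Gamma> i a p * \<Gamma> a k p)"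
    \<comment> \<open>With the sum over the frame innermost, only products of two frame components
      remain to be summed, which \<open>orthonormal_frame_on_sum\<close> evaluates.\<close>
    by (subst sum.swap) (simp add: sum_subtractf sum_distrib_right)
  finally show ?thesis
    by (simp add: orthonormal_frame_on_sum[OF assms(3,4)] matrix_inv_metric[OF p] L_def)
qed

end

subsection \<open>The harmonicity equations\<close>

lemma Ck_on_sum:
  assumes "open U" "finite A" "\<And>i. i \<in> A \<Longrightarrow> Ck_on k (F i) U"
  shows "Ck_on k (\<lambda>x. \<Sum>i\<in>A. F i x) U"
  using assms(2,3) by (induction A) (auto intro: Ck_on_const Ck_on_add[OF assms(1)])

lemma Ck_on_vec:
  fixes F :: "'a::euclidean_space \<Rightarrow> real^'n::finite"
  assumes "open U" "\<And>i. Ck_on k (\<lambda>x. F x $ i) U"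
  shows "Ck_on k F U"
proof -
  have "F = (\<lambda>x. \<Sum>i\<in>UNIV. F x $ i *\<^sub>R axis i 1)"
    by (simp add: fun_eq_iff vec_eq_iff axis_def if_distrib cong: if_cong)
  moreover have "Ck_on k (\<lambda>x. \<Sum>i\<in>UNIV. F x $ i *\<^sub>R axis i (1::real)) U"
    using assms by (intro Ck_on_sum Ck_on_bounded_linear[OF bounded_linear_scaleR_left]) auto
  ultimately show ?thesis by simp
qed

context translation_metric
begin

lemma Ck_on_s: "Ck_on k (s n a) U"
  unfolding s_def[abs_def] using mem_U
  by (intro Ck_on_compose_nth[OF open_U open_D smooth_deriv_P]) blast

lemma Ck_on_W: "Ck_on k W U"
  unfolding W_def[abs_def] power2_eq_square
  by (intro Ck_on_add Ck_on_const Ck_on_sum Ck_on_mult Ck_on_s open_U finite)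

text \<open>The columns of the inverse square root of the Gram matrix \<open>1 + \<nu> \<nu>\<^sup>T\<close>.\<close>

definition \<nu> :: "real^'n \<Rightarrow> real^'n" where
  "\<nu> x = (\<chi> a. s 1 a x)"

definition frame :: "'n \<Rightarrow> real^'n \<Rightarrow> real^'n" where
  "frame i x = axis i 1 - (s 1 i x * inverse (W x + sqrt (W x))) *\<^sub>R \<nu> x"

lemma inner_\<nu>: "\<nu> x \<bullet> \<nu> x = W x - 1" "axis i 1 \<bullet> \<nu> x = s 1 i x"
  by (simp add: \<nu>_def W_def inner_vec_def power2_eq_square) (simp add: \<nu>_def inner_axis')

lemma metric_mult_vec:
  assumes "x \<in> U"
  shows "g x *v v = v + (\<nu> x \<bullet> v) *\<^sub>R \<nu> x"
proof -
  have "(\<Sum>j\<in>UNIV. g x $ i $ j * v $ j)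
      = (\<Sum>j\<in>UNIV. (if i = j then v $ j else 0) + s 1 j x * v $ j * s 1 i x)" for i
    by (rule sum.cong) (auto simp: metric_s[OF assms] algebra_simps)
  then show ?thesis
    by (simp add: vec_eq_iff matrix_vector_mult_def \<nu>_def inner_vec_def sum.distrib sum_distrib_right)
qed

text \<open>A frame on all of \<open>U\<close> lets harmonicity, which quantifies over frames, be
  tested at every point.\<close>

lemma orthonormal_frame_on_frame: "orthonormal_frame_on U g frame"
  unfolding orthonormal_frame_on_def
proof (intro conjI allI ballI)
  fix i
  have pos: "W x + sqrt (W x) \<noteq> 0" for x
    using W_pos[of x] real_sqrt_gt_zero[OF W_pos[of x]] by linarith
  have "Ck_on k (\<lambda>x. frame i x $ a) U" for k a
  proof -
    have "Ck_on k (\<lambda>x. axis i 1 $ a + (- 1) * (s 1 i x * inverse (W x + sqrt (W x)) * s 1 a x)) U"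
      using W_pos pos
      by (intro Ck_on_add Ck_on_mult Ck_on_inverse Ck_on_sqrt Ck_on_const Ck_on_W Ck_on_s open_U)
    then show ?thesis by (simp add: frame_def \<nu>_def)
  qed
  then show "smooth_on (frame i) U"
    unfolding smooth_on_def by (blast intro: Ck_on_vec open_U)
next
  fix x i j assume x: "x \<in> U"
  \<comment> \<open>The frame vectors are the columns of \<open>1 - c \<nu> \<nu>\<^sup>T\<close>.
    As \<open>\<nu>\<close> has squared length \<open>r\<^sup>2 - 1\<close>, this matrix scales
    \<open>\<nu>\<close> by \<open>1 / r\<close>, as the inverse square root of the metric
    must.\<close>
  define r c where "r = sqrt (W x)" and "c = inverse (W x + r)"
  have r: "r > 0" "W x = r * r" using W_pos[of x] by (simp_all add: r_def)
  have c: "c = 1 / (r * (r + 1))" using r by (simp add: c_def field_simps)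
  have "frame i x \<bullet> (g x *v frame j x) = frame i x \<bullet> frame j x + (frame i x \<bullet> \<nu> x) * (frame j x \<bullet> \<nu> x)" for i j
    by (simp add: metric_mult_vec[OF x] inner_add_right inner_commute)
  moreover have "frame i x \<bullet> \<nu> x = s 1 i x / r" for i
  proof -
    have "frame i x \<bullet> \<nu> x = s 1 i x * (1 - c * (r * r - 1))"
      by (simp add: frame_def inner_diff_left inner_\<nu> c_def r_def[symmetric] r(2)[symmetric] algebra_simps del: One_nat_def)
    also have "1 - c * (r * r - 1) = 1 / r" using r(1) unfolding c
      by (simp add: divide_simps) (simp add: algebra_simps)
    finally show ?thesis by simp
  qed
  moreover have "frame i x \<bullet> frame j x = (if i = j then 1 else 0) - s 1 i x * s 1 j x / (r * r)"
  proof -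
    have "frame i x \<bullet> frame j x = (if i = j then 1 else 0) - s 1 i x * s 1 j x * (2 * c - c * c * (r * r - 1))"
      unfolding frame_def c_def[symmetric] r_def[symmetric]
      by (simp add: inner_diff_left inner_diff_right inner_\<nu> inner_axis_axis r(2)
          inner_commute[of "\<nu> x" "axis _ _"] algebra_simps del: One_nat_def)
    also have "2 * c - c * c * (r * r - 1) = 1 / (r * r)" using r(1) unfolding c
      by (simp add: divide_simps) (simp add: algebra_simps)
    finally show ?thesis by simp
  qed
  ultimately show "frame i x \<bullet> (g x *v frame j x) = (if i = j then 1 else 0)"
    by simp
qed

lemma harmonic_section_coordinate_field_iff:
  "harmonic_section U g (coordinate_field a) \<longleftrightarrow> (\<forall>x\<in>U. \<forall>k. L a k x = 0)"
proof
  assume "harmonic_section U g (coordinate_field a)"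
  then show "\<forall>x\<in>U. \<forall>k. L a k x = 0"
    using rough_laplacian_coordinate_field[OF open_U subset_refl orthonormal_frame_on_frame]
      open_U orthonormal_frame_on_frame
    unfolding harmonic_section_def by (metis subset_refl zero_index)
next
  assume L: "\<forall>x\<in>U. \<forall>k. L a k x = 0"
  show "harmonic_section U g (coordinate_field a)"
    unfolding harmonic_section_def
  proof (intro conjI allI impI ballI)
    show "smooth_on (coordinate_field a) U"
      by (simp add: smooth_on_def coordinate_field_def Ck_on_const)
    fix V e p
    assume V: "open V \<and> V \<subseteq> U \<and> orthonormal_frame_on V g e" "p \<in> V"
    then show "rough_laplacian g e (coordinate_field a) p = 0"
      using L rough_laplacian_coordinate_field[of V e p a] by (auto simp: vec_eq_iff)
  qed
qed

text \<open>If \<open>P a\<close> has zero second derivative, then \<open>\<Gamma> a\<close>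
  vanishes and the coordinate field is parallel. In \<open>L\<close> every term contains
  \<open>s 2 a\<close> or \<open>s 3 a\<close>.\<close>

lemma L_eq_0_if_affine:
  assumes "x \<in> U" "\<And>t. t \<in> D a \<Longrightarrow> (deriv ^^ 2) (P a) t = 0"
  shows "L a k x = 0"
proof -
  have s2: "s 2 a y = 0" if "y \<in> U" for y
    using that assms(2) mem_U by (simp add: s_def)
  have "partial a (s 2 a) x = partial a (\<lambda>x. 0) x"
    by (rule partial_cong[OF open_U assms(1) s2])
  moreover have "partial a (s 2 a) x = s 3 a x"
    using partial_s[OF assms(1), of a 2 a] by (simp add: eval_nat_numeral)
  moreover have "partial a (\<lambda>x. 0::real) x = 0"
    by (rule partial_eqI[OF has_derivative_const])
  ultimately have "s 3 a x = 0" by simp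
  then show ?thesis
    using s2[OF assms(1)] by (auto simp: L_def \<Gamma>_def d\<Gamma>_def intro!: sum.neutral)
qed

end

section \<open>The harmonicity equations in dimension two\<close>

locale translation_surface = translation_metric P D g U
  for P :: "2 \<Rightarrow> real \<Rightarrow> real" and D g U +
  assumes interval_D: "is_interval (D a)" and nonempty_D: "D a \<noteq> {}"
begin

text \<open>Working with any two distinct indices instead of 1 and 2 lets each identity below serve
  for both coordinate fields.\<close>

lemma UNIV_eq: "a \<noteq> b \<Longrightarrow> UNIV = {a, b :: 2}"
  using exhaust_2[of a] exhaust_2[of b] UNIV_2 by auto

lemma L_expand:
  fixes a b :: 2 and x
  assumes "a \<noteq> b"
  defines "A \<equiv> s 1 a x" and "B \<equiv> s 1 b x" and "A' \<equiv> s 2 a x" and "B' \<equiv> s 2 b x"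
    and "A'' \<equiv> s 3 a x"
  shows "L a a x * (W x)^3 = (W x - A * A) * ((A'' * A + A' * A') * W x - 2 * A' * A * A * A')
      + B * A * A' * A * B * B' - (W x - B * B) * B' * A * A' * A" (is ?same)
    and "L a b x * (W x)^3 = (W x - A * A) * (A'' * B * W x - 2 * A' * B * A * A')
      - B * A * (A' * B' * W x - A' * B * B * B') - (W x - B * B) * B' * A * A' * B" (is ?diff)
proof -
  note [simp] = assms(1) assms(1)[symmetric]
  note defs = L_def G_def \<Gamma>_def d\<Gamma>_def A_def B_def A'_def B'_def A''_def
    UNIV_eq[OF assms(1)]
  define w where "w = 1 / W x"
  \<comment> \<open>A common pattern for both components: they are polynomials in
    \<open>w = 1 / W\<close> of this shape, and multiplying by \<open>W\<^sup>3\<close> clears all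
    denominators.\<close>
  have clear: "((1 - A * A * w) * (X * w - Y * w * w) - p * w * (R * w - Q * w * w)
        - (1 - B * B * w) * Z * w * w) * (W x)^3
      = (W x - A * A) * (X * W x - Y) - p * (R * W x - Q) - (W x - B * B) * Z" for X Y Z p Q R
    using W_pos[of x] by (simp add: w_def field_simps power3_eq_cube)
  \<comment> \<open>Here \<open>R\<close> in \<open>clear\<close> is 0, because the direction
    \<open>b\<close> differs from both indices in \<open>d\<Gamma> b a a\<close>.\<close>
  have same: "L a a x = (1 - A * A * w) * ((A'' * A + A' * A') * w - 2 * A' * A * A * A' * w * w)
      - B * A * w * (0 * w - A' * A * B * B' * w * w)
      - (1 - B * B * w) * (B' * A * A' * A) * w * w"
    by (simp add: defs w_def power2_eq_square) (simp add: divide_inverse algebra_simps)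
  show ?same unfolding same clear by (simp add: algebra_simps)
  have diff: "L a b x = (1 - A * A * w) * (A'' * B * w - 2 * A' * B * A * A' * w * w)
      - B * A * w * (A' * B' * w - A' * B * B * B' * w * w)
      - (1 - B * B * w) * (B' * A * A' * B) * w * w"
    by (simp add: defs w_def power2_eq_square) (simp add: divide_inverse algebra_simps)
  show ?diff unfolding diff clear by (simp add: algebra_simps)
qed

lemma W_eq: "a \<noteq> b \<Longrightarrow> W x = 1 + (s 1 a x)\<^sup>2 + (s 1 b x)\<^sup>2" for a b :: 2
  by (simp add: W_def UNIV_eq)

lemma L_diagonal:
  fixes a b :: 2 and x
  assumes "a \<noteq> b"
  defines "A \<equiv> s 1 a x" and "B \<equiv> s 1 b x" and "A' \<equiv> s 2 a x" and "B' \<equiv> s 2 b x"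
  shows "L a a x * (W x)^3 = (1 + B\<^sup>2) * (A * s 3 a x * (1 + A\<^sup>2 + B\<^sup>2) + A'\<^sup>2 * (1 + B\<^sup>2 - A\<^sup>2))
    + A\<^sup>2 * A' * B' * (B\<^sup>2 - 1 - A\<^sup>2)"
  unfolding L_expand(1)[OF assms(1)]
  unfolding W_eq[OF assms(1)] assms(2-)
  by (simp add: power2_eq_square algebra_simps)

text \<open>The factor \<open>B\<close> makes this component vanish wherever \<open>B = 0\<close>;
  if the other profile is constant, only \<open>L_diagonal\<close> imposes a condition on
  \<open>P a\<close>.\<close>

lemma L_off_diagonal:
  fixes a b :: 2 and x
  assumes "a \<noteq> b"
  defines "A \<equiv> s 1 a x" and "B \<equiv> s 1 b x" and "A' \<equiv> s 2 a x" and "B' \<equiv> s 2 b x"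
  shows "L a b x * (W x)^3 = B * ((1 + B\<^sup>2) * (s 3 a x * (1 + A\<^sup>2 + B\<^sup>2) - 2 * A * A'\<^sup>2)
    - 2 * A * A' * B' * (1 + A\<^sup>2))"
  unfolding L_expand(2)[OF assms(1)]
  unfolding W_eq[OF assms(1)] assms(2-)
  by (simp add: power2_eq_square algebra_simps)

end

section \<open>One-variable calculus and pointwise elimination\<close>

lemma has_field_derivative_eq_on_open:
  fixes f g :: "real \<Rightarrow> real"
  assumes "open I" "t \<in> I" "\<And>x. x \<in> I \<Longrightarrow> f x = g x"
    and "(f has_field_derivative c) (at t)" "(g has_field_derivative d) (at t)"
  shows "c = d"
  using has_field_derivative_transform_within_open[OF assms(4,1,2,3)] assms(5) DERIV_unique by blast

lemma interval_derivative_zero_constant: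
  fixes f :: "real \<Rightarrow> real"
  assumes "is_interval I" "\<And>t. t \<in> I \<Longrightarrow> (f has_field_derivative 0) (at t)"
  obtains c where "\<And>t. t \<in> I \<Longrightarrow> f t = c"
  using has_field_derivative_zero_constant[OF is_interval_convex[OF assms(1)]] assms(2)
    has_field_derivative_at_within by metis

text \<open>The square of \<open>p\<close> has derivative 0 and is therefore constant, so
  \<open>p\<close> either has no zero or vanishes identically.\<close>

lemma derivative_eq_0_if_mult_eq_0:
  fixes p :: "real \<Rightarrow> real"
  assumes "open I" "is_interval I"
    and der: "\<And>t. t \<in> I \<Longrightarrow> (p has_field_derivative p' t) (at t)"
    and "\<And>t. t \<in> I \<Longrightarrow> p t * p' t = 0" and "t \<in> I"
  shows "p' t = 0"
proof (cases "\<exists>u\<in>I. p u \<noteq> 0")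
  case True
  then obtain u where u: "u \<in> I" "p u \<noteq> 0" by blast
  have "((\<lambda>t. p t * p t) has_field_derivative 0) (at t)" if "t \<in> I" for t
    using DERIV_mult[OF der[OF that] der[OF that]] assms(4)[OF that] by (simp add: mult.commute)
  then obtain c where c: "\<And>t. t \<in> I \<Longrightarrow> p t * p t = c"
    using interval_derivative_zero_constant[OF assms(2), of "\<lambda>t. p t * p t"] by metis
  have "p t \<noteq> 0"
    using c[OF \<open>t \<in> I\<close>] c[OF u(1)] u(2) by auto
  then show ?thesis using assms(4)[OF \<open>t \<in> I\<close>] by simp
next
  case False
  then show ?thesis
    using has_field_derivative_eq_on_open[OF assms(1,5) _ der[OF assms(5)] DERIV_const] by blast
qed

lemma derivative_eq_0_if_harmonic:
  fixes p q p' q' p'' q'' :: real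
  assumes "p \<noteq> 0" "q \<noteq> 0"
    and pp: "(1 + q\<^sup>2) * (p * p'' * (1 + p\<^sup>2 + q\<^sup>2) + p'\<^sup>2 * (1 + q\<^sup>2 - p\<^sup>2))
      + p\<^sup>2 * p' * q' * (q\<^sup>2 - 1 - p\<^sup>2) = 0"
    and pq: "(1 + q\<^sup>2) * (p'' * (1 + p\<^sup>2 + q\<^sup>2) - 2 * p * p'\<^sup>2) - 2 * p * p' * q' * (1 + p\<^sup>2) = 0"
    and qq: "(1 + p\<^sup>2) * (q * q'' * (1 + q\<^sup>2 + p\<^sup>2) + q'\<^sup>2 * (1 + p\<^sup>2 - q\<^sup>2))
      + q\<^sup>2 * q' * p' * (p\<^sup>2 - 1 - q\<^sup>2) = 0"
    and qp: "(1 + p\<^sup>2) * (q'' * (1 + q\<^sup>2 + p\<^sup>2) - 2 * q * q'\<^sup>2) - 2 * q * q' * p' * (1 + q\<^sup>2) = 0"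
  shows "p' = 0"
proof (rule ccontr)
  assume "p' \<noteq> 0"
  define w where "w = 1 + p\<^sup>2 + q\<^sup>2"
  have "w > 0" unfolding w_def by (smt (verit) zero_le_power2)
  \<comment> \<open>Subtracting \<open>p\<close> times the off-diagonal equation from the diagonal
    one cancels \<open>p''\<close>, and \<open>w\<close> factors out of the rest.\<close>
  have "w * (p' * ((1 + q\<^sup>2) * p' + p\<^sup>2 * q'))
      = ((1 + q\<^sup>2) * (p * p'' * (1 + p\<^sup>2 + q\<^sup>2) + p'\<^sup>2 * (1 + q\<^sup>2 - p\<^sup>2)) + p\<^sup>2 * p' * q' * (q\<^sup>2 - 1 - p\<^sup>2))
        - p * ((1 + q\<^sup>2) * (p'' * (1 + p\<^sup>2 + q\<^sup>2) - 2 * p * p'\<^sup>2) - 2 * p * p' * q' * (1 + p\<^sup>2))"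
    unfolding w_def by (simp add: power2_eq_square algebra_simps)
  then have 1: "(1 + q\<^sup>2) * p' + p\<^sup>2 * q' = 0"
    unfolding pp pq using \<open>w > 0\<close> \<open>p' \<noteq> 0\<close> by simp
  have "w * (q' * ((1 + p\<^sup>2) * q' + q\<^sup>2 * p'))
      = ((1 + p\<^sup>2) * (q * q'' * (1 + q\<^sup>2 + p\<^sup>2) + q'\<^sup>2 * (1 + p\<^sup>2 - q\<^sup>2)) + q\<^sup>2 * q' * p' * (p\<^sup>2 - 1 - q\<^sup>2))
        - q * ((1 + p\<^sup>2) * (q'' * (1 + q\<^sup>2 + p\<^sup>2) - 2 * q * q'\<^sup>2) - 2 * q * q' * p' * (1 + q\<^sup>2))"
    unfolding w_def by (simp add: power2_eq_square algebra_simps)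
  moreover have "1 + q\<^sup>2 \<noteq> 0" by (smt (verit) zero_le_power2)
  then have "q' \<noteq> 0"
    using 1 \<open>p' \<noteq> 0\<close> by (metis add.right_neutral mult_eq_0_iff)
  ultimately have 2: "(1 + p\<^sup>2) * q' + q\<^sup>2 * p' = 0"
    unfolding qq qp using \<open>w > 0\<close> by simp
  \<comment> \<open>Cramer's rule for the linear system formed by the facts 1 and 2, whose
    determinant is \<open>w\<close>.\<close>
  have "p' * w = (1 + p\<^sup>2) * ((1 + q\<^sup>2) * p' + p\<^sup>2 * q') - p\<^sup>2 * ((1 + p\<^sup>2) * q' + q\<^sup>2 * p')"
    unfolding w_def by (simp add: algebra_simps)
  then show False
    unfolding 1 2 using \<open>p' \<noteq> 0\<close> \<open>w > 0\<close> by simp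
qed

text \<open>Up to the factor \<open>(1 + f'\<^sup>2)\<^sup>2\<close>, the left-hand side is the derivative of
  \<open>f' f'' / (1 + f'\<^sup>2)\<close>.\<close>

definition profile_ode :: "(real \<Rightarrow> real) \<Rightarrow> real set \<Rightarrow> bool" where
  "profile_ode f I \<longleftrightarrow> (\<forall>t\<in>I. deriv f t * (deriv ^^ 3) f t * (1 + (deriv f t)\<^sup>2)
      + ((deriv ^^ 2) f t)\<^sup>2 * (1 - (deriv f t)\<^sup>2) = 0)"

context translation_surface
begin

lemma eq_or_eq: "a \<noteq> b \<Longrightarrow> i = a \<or> i = b" for a b :: 2
  using UNIV_eq by blast

lemma mem_U_2:
  assumes "a \<noteq> b"
  shows "x \<in> U \<longleftrightarrow> x $ a \<in> D a \<and> x $ b \<in> D b"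
proof
  assume "x $ a \<in> D a \<and> x $ b \<in> D b"
  then have "x $ i \<in> D i" for i
    using eq_or_eq[OF assms, of i] by blast
  then show "x \<in> U" by (simp add: mem_U)
qed (simp add: mem_U)

lemma ex_other: "\<exists>b. a \<noteq> b" for a :: 2
  by (rule exI[of _ "a + 1"]) simp

lemma obtain_point:
  assumes "a \<noteq> b" "t \<in> D a" "u \<in> D b"
  obtains x where "x \<in> U" "x $ a = t" "x $ b = u"
  using that[of "\<chi> i. if i = a then t else u"] mem_U_2[OF assms(1)] assms by simp

lemma deriv_2_eq_0_if_constant:
  assumes "\<And>t. t \<in> D b \<Longrightarrow> deriv (P b) t = 0" and "t \<in> D b"
  shows "(deriv ^^ 2) (P b) t = 0"
  using has_field_derivative_eq_on_open[OF open_D assms(2,1)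
      smooth_on_deriv(2)[OF open_D smooth_on_deriv(1)[OF open_D smooth_P] assms(2)] DERIV_const]
  by (simp add: numeral_2_eq_2)

lemma profile_ode_if_constant:
  assumes L: "\<And>x. x \<in> U \<Longrightarrow> L a a x = 0" and "a \<noteq> b"
    and const: "\<And>t. t \<in> D b \<Longrightarrow> deriv (P b) t = 0"
  shows "profile_ode (P a) (D a)"
  unfolding profile_ode_def
proof
  fix t assume "t \<in> D a"
  obtain u where "u \<in> D b" using nonempty_D by blast
  obtain x where x: "x \<in> U" "x $ a = t" "x $ b = u"
    using obtain_point[OF \<open>a \<noteq> b\<close> \<open>t \<in> D a\<close> \<open>u \<in> D b\<close>] .
  have "s 1 b x = 0" "s 2 b x = 0"
    using const deriv_2_eq_0_if_constant[OF const] x \<open>u \<in> D b\<close> by (simp_all add: s_def)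
  then show "deriv (P a) t * (deriv ^^ 3) (P a) t * (1 + (deriv (P a) t)\<^sup>2)
      + ((deriv ^^ 2) (P a) t)\<^sup>2 * (1 - (deriv (P a) t)\<^sup>2) = 0"
    using L[OF x(1)] L_diagonal[OF \<open>a \<noteq> b\<close>, of x] x(2) by (simp add: s_def)
qed

text \<open>One \<open>u\<close> with nonzero derivative of the other profile serves for every
  \<open>t\<close>, since the equations hold on the whole product. Elimination then gives
  \<open>p p' = 0\<close> on \<open>D a\<close>, and connectedness removes the exceptional zeros of
  \<open>p\<close>.\<close>

lemma second_derivative_eq_0:
  assumes L: "\<And>x a k. x \<in> U \<Longrightarrow> L a k x = 0"
    and nonconst: "\<And>a. \<exists>t\<in>D a. deriv (P a) t \<noteq> 0"
    and "t \<in> D a"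
  shows "(deriv ^^ 2) (P a) t = 0"
proof -
  define p where "p = deriv (P a)"
  have der: "(p has_field_derivative (deriv ^^ 2) (P a) t) (at t)" if "t \<in> D a" for t
    using smooth_on_deriv(2)[OF open_D smooth_deriv_P[of 1 a] that]
    by (simp add: p_def numeral_2_eq_2)
  obtain b where "a \<noteq> b" using ex_other by blast
  obtain u where u: "u \<in> D b" "deriv (P b) u \<noteq> 0" using nonconst by blast
  have pointwise: "(deriv ^^ 2) (P a) t = 0" if t: "t \<in> D a" "p t \<noteq> 0" for t
  proof -
    obtain x where x: "x \<in> U" "x $ a = t" "x $ b = u"
      using obtain_point[OF \<open>a \<noteq> b\<close> t(1) u(1)] .
    have nz: "s 1 a x \<noteq> 0" "s 1 b x \<noteq> 0"
      using x t(2) u(2) by (simp_all add: s_def p_def)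
    note eqs = L_diagonal[OF \<open>a \<noteq> b\<close>, of x] L_off_diagonal[OF \<open>a \<noteq> b\<close>, of x]
      L_diagonal[OF \<open>a \<noteq> b\<close>[symmetric], of x] L_off_diagonal[OF \<open>a \<noteq> b\<close>[symmetric], of x]
    have "s 2 a x = 0"
    proof (rule derivative_eq_0_if_harmonic[OF nz])
      show "(1 + (s 1 b x)\<^sup>2) * (s 3 a x * (1 + (s 1 a x)\<^sup>2 + (s 1 b x)\<^sup>2) - 2 * s 1 a x * (s 2 a x)\<^sup>2)
          - 2 * s 1 a x * s 2 a x * s 2 b x * (1 + (s 1 a x)\<^sup>2) = 0"
        using eqs(2) nz(2) unfolding L[OF x(1)] by (metis mult_eq_0_iff)
      show "(1 + (s 1 a x)\<^sup>2) * (s 3 b x * (1 + (s 1 b x)\<^sup>2 + (s 1 a x)\<^sup>2) - 2 * s 1 b x * (s 2 b x)\<^sup>2)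
          - 2 * s 1 b x * s 2 b x * s 2 a x * (1 + (s 1 b x)\<^sup>2) = 0"
        using eqs(4) nz(1) unfolding L[OF x(1)] by (metis mult_eq_0_iff)
    qed (use eqs(1,3) in \<open>simp_all only: L[OF x(1)] mult_zero_left\<close>)
    then show ?thesis using x by (simp add: s_def)
  qed
  have "p t * (deriv ^^ 2) (P a) t = 0" if "t \<in> D a" for t
    using pointwise[OF that] by auto
  then show ?thesis
    using derivative_eq_0_if_mult_eq_0[OF open_D interval_D der] \<open>t \<in> D a\<close> by blast
qed

text \<open>For the field \<open>a\<close>, the diagonal equation becomes the profile equation and
  the off-diagonal one is trivial; the field \<open>b\<close> is parallel.\<close>

lemma L_eq_0_if_profile_ode:
  assumes "a \<noteq> b" "profile_ode (P a) (D a)" and const: "\<And>t. t \<in> D b \<Longrightarrow> deriv (P b) t = 0"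
    and "x \<in> U"
  shows "L i k x = 0"
proof -
  note * = deriv_2_eq_0_if_constant[OF const]
  have "s 1 b x = 0" "s 2 b x = 0"
    using const * \<open>x \<in> U\<close> mem_U by (simp_all add: s_def)
  moreover have "s 1 a x * s 3 a x * (1 + (s 1 a x)\<^sup>2) + (s 2 a x)\<^sup>2 * (1 - (s 1 a x)\<^sup>2) = 0"
    using assms(2) \<open>x \<in> U\<close> mem_U by (simp add: profile_ode_def s_def)
  ultimately have "L a a x * (W x)^3 = 0" "L a b x * (W x)^3 = 0"
    using L_diagonal[OF \<open>a \<noteq> b\<close>, of x] L_off_diagonal[OF \<open>a \<noteq> b\<close>, of x] by simp_all
  then have "L a k x = 0"
    using W_pos[of x] eq_or_eq[OF \<open>a \<noteq> b\<close>, of k] by auto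
  moreover have "L b k x = 0"
    using L_eq_0_if_affine[OF \<open>x \<in> U\<close>, of b] * by blast
  ultimately show ?thesis
    using eq_or_eq[OF \<open>a \<noteq> b\<close>, of i] by blast
qed

theorem harmonic_sections_iff:
  "(\<forall>a. harmonic_section U g (coordinate_field a)) \<longleftrightarrow>
    (\<forall>a. \<forall>t\<in>D a. (deriv ^^ 2) (P a) t = 0) \<or>
    (\<exists>a b. a \<noteq> b \<and> profile_ode (P a) (D a) \<and> (\<forall>t\<in>D b. deriv (P b) t = 0))"
  unfolding harmonic_section_coordinate_field_iff
proof
  assume L: "\<forall>a. \<forall>x\<in>U. \<forall>k. L a k x = 0"
  show "(\<forall>a. \<forall>t\<in>D a. (deriv ^^ 2) (P a) t = 0) \<or>
    (\<exists>a b. a \<noteq> b \<and> profile_ode (P a) (D a) \<and> (\<forall>t\<in>D b. deriv (P b) t = 0))"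
  proof (cases "\<exists>b. \<forall>t\<in>D b. deriv (P b) t = 0")
    case True
    then obtain b where b: "\<And>t. t \<in> D b \<Longrightarrow> deriv (P b) t = 0" by blast
    obtain a where "a \<noteq> b" using ex_other[of b] by metis
    then show ?thesis
      using profile_ode_if_constant[OF _ \<open>a \<noteq> b\<close> b] L b by blast
  next
    case False
    then have "(deriv ^^ 2) (P a) t = 0" if "t \<in> D a" for a t
      by (intro second_derivative_eq_0 that) (use L in auto)
    then show ?thesis by blast
  qed
next
  assume "(\<forall>a. \<forall>t\<in>D a. (deriv ^^ 2) (P a) t = 0) \<or>
    (\<exists>a b. a \<noteq> b \<and> profile_ode (P a) (D a) \<and> (\<forall>t\<in>D b. deriv (P b) t = 0))"
  then show "\<forall>a. \<forall>x\<in>U. \<forall>k. L a k x = 0"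
    by (elim disjE exE conjE) (auto intro: L_eq_0_if_affine L_eq_0_if_profile_ode)
qed

end

subsection \<open>The profile equation and the translation surface\<close>

text \<open>With \<open>r = sqrt Q\<close> and \<open>Q' = 2 (Q + 1) / c0\<close>, the two terms
  have derivatives \<open>(r\<^sup>2 + 1) / r\<close> and \<open>1 / r\<close>, whose difference is
  \<open>r\<close>.\<close>

lemma exponential_profile_has_derivative:
  fixes c0 \<alpha> t :: real
  defines "Q \<equiv> \<lambda>t. \<alpha> * exp (2 * t / c0) - 1"
  assumes "c0 \<noteq> 0" "Q t > 0"
  shows "((\<lambda>t. c0 * sqrt (Q t) - c0 * arctan (sqrt (Q t))) has_field_derivative sqrt (Q t)) (at t)"
proof -
  define r where "r = sqrt (Q t)"
  have r: "r > 0" "r * r = Q t" using assms(3) by (simp_all add: r_def)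
  have Q': "(Q has_field_derivative 2 / c0 * (Q t + 1)) (at t)"
    unfolding Q_def using assms(2) by (auto intro!: derivative_eq_intros simp: field_simps)
  have sqrt': "((\<lambda>t. sqrt (Q t)) has_field_derivative (r * r + 1) / (c0 * r)) (at t)"
    using DERIV_chain2[OF DERIV_real_sqrt[OF assms(3)] Q']
    unfolding r_def[symmetric] r(2)[symmetric]
    by (rule DERIV_cong) (use r(1) assms(2) in \<open>simp add: field_simps\<close>)
  have arctan': "((\<lambda>t. arctan (sqrt (Q t))) has_field_derivative 1 / (c0 * r)) (at t)"
    using DERIV_chain2[OF DERIV_arctan sqrt'] unfolding r_def[symmetric] power2_eq_square
    by (rule DERIV_cong) (use r(1) in \<open>simp add: add_nonneg_eq_0_iff divide_simps\<close>)
  show ?thesis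
    using DERIV_diff[OF DERIV_cmult[OF sqrt', of c0] DERIV_cmult[OF arctan', of c0]]
    unfolding r_def[symmetric] by (rule DERIV_cong) (use r assms(2) in \<open>simp add: field_simps\<close>)
qed

context
  fixes f :: "real \<Rightarrow> real" and I
  assumes I: "open I" "is_interval I" and f: "smooth_on f I"
begin

lemma deriv_123:
  assumes "t \<in> I"
  shows "(f has_field_derivative deriv f t) (at t)"
    and "(deriv f has_field_derivative (deriv ^^ 2) f t) (at t)"
    and "((deriv ^^ 2) f has_field_derivative (deriv ^^ 3) f t) (at t)"
  using smooth_on_deriv[OF I(1) f]
    smooth_on_deriv[OF I(1) smooth_on_deriv(1)[OF I(1) f]]
    smooth_on_deriv(2)[OF I(1) smooth_on_deriv(1)[OF I(1) smooth_on_deriv(1)[OF I(1) f]]] assms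
  by (auto simp: eval_nat_numeral)

lemma constant_function_on_iff: "constant_function_on I f \<longleftrightarrow> (\<forall>t\<in>I. deriv f t = 0)"
proof
  assume "constant_function_on I f"
  then obtain k where "\<And>t. t \<in> I \<Longrightarrow> f t = k"
    unfolding constant_function_on_def by blast
  then show "\<forall>t\<in>I. deriv f t = 0"
    using has_field_derivative_eq_on_open[OF I(1) _ _ deriv_123(1) DERIV_const] by blast
next
  assume "\<forall>t\<in>I. deriv f t = 0"
  then obtain c where "\<And>t. t \<in> I \<Longrightarrow> f t = c"
    using interval_derivative_zero_constant[OF I(2), of f] deriv_123(1) by metis
  then show "constant_function_on I f"
    unfolding constant_function_on_def by blast
qed

lemma affine_function_on_iff: "affine_function_on I f \<longleftrightarrow> (\<forall>t\<in>I. (deriv ^^ 2) f t = 0)"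
proof
  assume "affine_function_on I f"
  then obtain a0 a1 where *: "\<And>t. t \<in> I \<Longrightarrow> f t = a0 * t + a1"
    unfolding affine_function_on_def by blast
  have "((\<lambda>t. a0 * t + a1) has_field_derivative a0) (at t)" for t
    by (auto intro!: derivative_eq_intros)
  then have "deriv f t = a0" if "t \<in> I" for t
    using has_field_derivative_eq_on_open[OF I(1) that * deriv_123(1)[OF that]] by blast
  then show "\<forall>t\<in>I. (deriv ^^ 2) f t = 0"
    using has_field_derivative_eq_on_open[OF I(1) _ _ deriv_123(2) DERIV_const] by blast
next
  assume "\<forall>t\<in>I. (deriv ^^ 2) f t = 0"
  then obtain a0 where a0: "\<And>t. t \<in> I \<Longrightarrow> deriv f t = a0"
    using interval_derivative_zero_constant[OF I(2), of "deriv f"] deriv_123(2) by metis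
  have "((\<lambda>t. f t - a0 * t) has_field_derivative 0) (at t)" if "t \<in> I" for t
    using deriv_123(1)[OF that] a0[OF that] by (auto intro!: derivative_eq_intros)
  then obtain a1 where "\<And>t. t \<in> I \<Longrightarrow> f t - a0 * t = a1"
    using interval_derivative_zero_constant[OF I(2), of "\<lambda>t. f t - a0 * t"] by metis
  then have "\<forall>t\<in>I. f t = a0 * t + a1"
    by (simp add: algebra_simps)
  then show "affine_function_on I f"
    unfolding affine_function_on_def by blast
qed

text \<open>Squaring \<open>f' = \<sigma> sqrt Q\<close> removes both the sign and the root.
  Differentiating \<open>f'\<^sup>2 = Q\<close> gives a first integral of the equation, which is
  differentiated once more.\<close>

lemma profile_ode_if_exponential:
  assumes "exponential_profile_on I f"
  shows "profile_ode f I"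
  unfolding profile_ode_def
proof
  fix t assume t: "t \<in> I"
  obtain c0 c1 \<alpha> \<sigma> where c0: "c0 \<noteq> 0" and \<sigma>: "\<sigma> = 1 \<or> \<sigma> = -1"
    and pos: "\<And>u. u \<in> I \<Longrightarrow> \<alpha> * exp (2 * u / c0) - 1 > 0"
    and f_eq: "\<And>u. u \<in> I \<Longrightarrow> f u = \<sigma> * (c0 * sqrt (\<alpha> * exp (2 * u / c0) - 1)
                    - c0 * arctan (sqrt (\<alpha> * exp (2 * u / c0) - 1)) + c1)"
    using assms unfolding exponential_profile_on_def by blast
  define Q where "Q = (\<lambda>u. \<alpha> * exp (2 * u / c0) - 1)"
  let ?p = "deriv f" and ?p1 = "(deriv ^^ 2) f" and ?p2 = "(deriv ^^ 3) f"
  have p: "?p u = \<sigma> * sqrt (Q u)" if "u \<in> I" for u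
    using has_field_derivative_eq_on_open[OF I(1) that f_eq deriv_123(1)[OF that]
        DERIV_cmult[OF DERIV_add[OF exponential_profile_has_derivative[OF c0 pos[OF that]]
          DERIV_const]]] by (simp add: Q_def)
  have p_sq: "?p u * ?p u = Q u" if "u \<in> I" for u
    using pos[OF that] \<sigma> by (auto simp: p[OF that] Q_def)
  have Q': "(Q has_field_derivative 2 / c0 * (Q u + 1)) (at u)" for u
    unfolding Q_def using c0 by (auto intro!: derivative_eq_intros simp: field_simps)
  have 1: "?p u * ?p1 u = (1 + ?p u * ?p u) / c0" if "u \<in> I" for u
    using has_field_derivative_eq_on_open[OF I(1) that p_sq
        DERIV_mult[OF deriv_123(2)[OF that] deriv_123(2)[OF that]] Q'] c0 p_sq[OF that]
    by (simp add: field_simps)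
  have "((\<lambda>u. (1 + ?p u * ?p u) / c0) has_field_derivative 2 * ?p t * ?p1 t / c0) (at t)"
    using c0 by (auto intro!: derivative_eq_intros deriv_123(2)[OF t])
  from has_field_derivative_eq_on_open[OF I(1) t 1
      DERIV_mult[OF deriv_123(2)[OF t] deriv_123(3)[OF t]] this]
  have "?p1 t * ?p1 t + ?p2 t * ?p t = 2 * ?p t * ?p1 t / c0" .
  \<comment> \<open>After this multiplication \<open>c0\<close> occurs only in
    \<open>(1 + f'\<^sup>2) / c0\<close>, which the first integral replaces by
    \<open>f' f''\<close>.\<close>
  then have "(?p1 t * ?p1 t + ?p2 t * ?p t) * (1 + ?p t * ?p t)
      = 2 * (?p t * ?p1 t) * ((1 + ?p t * ?p t) / c0)"
    by simp
  then have "(?p1 t * ?p1 t + ?p2 t * ?p t) * (1 + ?p t * ?p t) = 2 * (?p t * ?p1 t) * (?p t * ?p1 t)"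
    by (simp only: 1[OF t])
  then show "?p t * ?p2 t * (1 + (?p t)\<^sup>2) + (?p1 t)\<^sup>2 * (1 - (?p t)\<^sup>2) = 0"
    by (simp add: power2_eq_square algebra_simps)
qed

lemma affine_or_exponential_if_profile_ode:
  assumes "profile_ode f I"
  shows "affine_function_on I f \<or> exponential_profile_on I f"
proof (cases "I = {}")
  case True
  then show ?thesis by (simp add: affine_function_on_def)
next
  case False
  let ?p = "deriv f" and ?p1 = "(deriv ^^ 2) f" and ?p2 = "(deriv ^^ 3) f"
  have pos: "1 + ?p t * ?p t > 0" for t
    by (smt (verit) zero_le_square)
  have quot: "((\<lambda>t. ?p t * ?p1 t / (1 + ?p t * ?p t)) has_field_derivative 0) (at t)" if "t \<in> I" for t
  proof -
    have "((\<lambda>t. ?p t * ?p1 t / (1 + ?p t * ?p t)) has_field_derivative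
        ((?p1 t * ?p1 t + ?p2 t * ?p t) * (1 + ?p t * ?p t) - ?p t * ?p1 t * (0 + (?p1 t * ?p t + ?p1 t * ?p t)))
          / ((1 + ?p t * ?p t) * (1 + ?p t * ?p t))) (at t)"
      using pos[of t]
      by (intro DERIV_divide DERIV_mult DERIV_add DERIV_const deriv_123 that) simp
    moreover have "(?p1 t * ?p1 t + ?p2 t * ?p t) * (1 + ?p t * ?p t)
        - ?p t * ?p1 t * (0 + (?p1 t * ?p t + ?p1 t * ?p t)) = 0"
      using assms that by (simp add: profile_ode_def power2_eq_square algebra_simps)
    ultimately show ?thesis by simp
  qed
  obtain c where "\<And>t. t \<in> I \<Longrightarrow> ?p t * ?p1 t / (1 + ?p t * ?p t) = c"
    using interval_derivative_zero_constant[OF I(2) quot] by blast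
  then have c: "?p t * ?p1 t = c * (1 + ?p t * ?p t)" if "t \<in> I" for t
    using that pos[of t] by (simp add: divide_eq_eq)
  show ?thesis
  \<comment> \<open>For \<open>c = 0\<close> the first integral says \<open>f' f'' = 0\<close>, so
    \<open>f\<close> is affine; otherwise \<open>1 / c\<close> becomes the constant
    \<open>c0\<close>.\<close>
  proof (cases "c = 0")
    case True
    then show ?thesis
      using derivative_eq_0_if_mult_eq_0[OF I deriv_123(2)] c affine_function_on_iff by auto
  next
    case False
    \<comment> \<open>The first integral is the linear equation \<open>y' = 2 c y\<close> for
      \<open>y = 1 + f'\<^sup>2\<close>; the exponential is its integrating factor.\<close>
    have energy: "((\<lambda>t. (1 + ?p t * ?p t) * exp (- (2 * c * t))) has_field_derivative 0) (at t)"
      if "t \<in> I" for t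
    proof -
      have "((\<lambda>t. (1 + ?p t * ?p t) * exp (- (2 * c * t))) has_field_derivative
          2 * (?p t * ?p1 t) * exp (- (2 * c * t)) - (1 + ?p t * ?p t) * (2 * c * exp (- (2 * c * t)))) (at t)"
        by (auto intro!: derivative_eq_intros deriv_123(2)[OF that])
      then show ?thesis by (simp add: c[OF that] algebra_simps)
    qed
    obtain \<alpha> where \<alpha>: "\<And>t. t \<in> I \<Longrightarrow> (1 + ?p t * ?p t) * exp (- (2 * c * t)) = \<alpha>"
      using interval_derivative_zero_constant[OF I(2) energy] by blast
    define c0 where "c0 = 1 / c"
    have c0: "c0 \<noteq> 0" using False by (simp add: c0_def)
    define Q where "Q t = \<alpha> * exp (2 * t / c0) - 1" for t
    have Q: "Q t = ?p t * ?p t" if "t \<in> I" for t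
      unfolding Q_def c0_def \<alpha>[OF that, symmetric] by (simp add: exp_minus field_simps)
    obtain t0 where "t0 \<in> I" using \<open>I \<noteq> {}\<close> by blast
    then have "\<alpha> > 0" using \<alpha>[of t0] pos[of t0] by auto
    have nz: "?p t \<noteq> 0" if "t \<in> I" for t
      using c[OF that] False by auto
    have Q_pos: "Q t > 0" if "t \<in> I" for t
      using nz[OF that] by (auto simp: Q[OF that] zero_less_mult_iff neq_iff)
    \<comment> \<open>A nowhere vanishing continuous derivative has constant sign on the interval,
      so one \<open>\<sigma>\<close> serves for all of \<open>I\<close>.\<close>
    have "continuous_on I ?p"
      using deriv_123(2) DERIV_isCont continuous_at_imp_continuous_on by blast
    then have "is_interval (?p ` I)"
      using connected_continuous_image I(2) is_interval_connected_1 by blast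
    then have "0 \<in> ?p ` I" if "t \<in> I" "u \<in> I" "?p t \<le> 0" "?p u \<ge> 0" for t u
      using mem_is_interval_1_I[of "?p ` I" "?p t" "?p u" 0] that by blast
    then have "(\<forall>t\<in>I. ?p t > 0) \<or> (\<forall>t\<in>I. ?p t < 0)"
      using nz by (smt (verit, best) imageE)
    moreover have "sqrt (Q t) = \<bar>?p t\<bar>" if "t \<in> I" for t
      by (simp add: Q[OF that])
    ultimately have "\<exists>\<sigma>\<in>{1, -1}. \<forall>t\<in>I. ?p t = \<sigma> * sqrt (Q t)"
      by auto
    then obtain \<sigma> where \<sigma>: "\<sigma> = 1 \<or> \<sigma> = -1" "\<And>t. t \<in> I \<Longrightarrow> ?p t = \<sigma> * sqrt (Q t)"
      by blast
    let ?H = "\<lambda>t. c0 * sqrt (Q t) - c0 * arctan (sqrt (Q t))"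
    have diff: "((\<lambda>t. f t - \<sigma> * ?H t) has_field_derivative 0) (at t)" if "t \<in> I" for t
      using DERIV_diff[OF deriv_123(1)[OF that] DERIV_cmult[OF exponential_profile_has_derivative[OF c0
            Q_pos[OF that, unfolded Q_def]], of \<sigma>]] \<sigma>(2)[OF that]
      by (simp add: Q_def)
    obtain k where k: "\<And>t. t \<in> I \<Longrightarrow> f t - \<sigma> * ?H t = k"
      using interval_derivative_zero_constant[OF I(2) diff] by blast
    \<comment> \<open>Since \<open>\<sigma>\<^sup>2 = 1\<close>, the integration constant can be
      moved inside the bracket as \<open>c1 = \<sigma> k\<close>.\<close>
    have "f t = \<sigma> * (?H t + \<sigma> * k)" if "t \<in> I" for t
      using k[OF that] \<sigma>(1) by (auto simp: algebra_simps)
    then have "exponential_profile_on I f"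
      unfolding exponential_profile_on_def
      by (intro exI[of _ c0] exI[of _ "\<sigma> * k"] exI[of _ \<alpha>] exI[of _ \<sigma>])
        (use c0 \<open>\<alpha> > 0\<close> \<sigma>(1) Q_pos in \<open>simp add: Q_def\<close>)
    then show ?thesis ..
  qed
qed

end

section \<open>The surface in space and the classification\<close>

lemma planar_surface_if_affine:
  assumes "open I" "open J" "affine_function_on I f" "affine_function_on J h"
  shows "planar_surface (translation_param f h ` coordinate_rectangle I J)"
proof -
  obtain a0 a1 where f: "\<And>u. u \<in> I \<Longrightarrow> f u = a0 * u + a1"
    using assms(3) unfolding affine_function_on_def by blast
  obtain b0 b1 where h: "\<And>u. u \<in> J \<Longrightarrow> h u = b0 * u + b1"
    using assms(4) unfolding affine_function_on_def by blast
  define n :: "real^3" where "n = vector [- a0, - b0, 1]"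
  define P where "P = {x. n \<bullet> x = a1 + b1}"
  have n_inner: "n \<bullet> x = x $ 3 - a0 * x $ 1 - b0 * x $ 2" for x
    by (simp add: n_def inner_vec_def sum_3)
  have "n \<noteq> 0"
    unfolding n_def by (metis vector_3(3) zero_index zero_neq_one)
  then have "affine P" "aff_dim P = 2"
    unfolding P_def by (simp_all add: affine_hyperplane aff_dim_hyperplane)
  \<comment> \<open>The first two coordinates of a surface point are its parameters, so the image is
    the plane cut by an open cylinder over the rectangle.\<close>
  moreover have "translation_param f h ` coordinate_rectangle I J
      = P \<inter> ((\<lambda>x. x $ 1) -` I \<inter> (\<lambda>x. x $ 2) -` J)"
  proof (intro equalityI subsetI)
    fix x assume "x \<in> translation_param f h ` coordinate_rectangle I J"
    then show "x \<in> P \<inter> ((\<lambda>x. x $ 1) -` I \<inter> (\<lambda>x. x $ 2) -` J)"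
      by (auto simp: P_def n_inner translation_param_def coordinate_rectangle_def f h)
  next
    fix x assume x: "x \<in> P \<inter> ((\<lambda>x. x $ 1) -` I \<inter> (\<lambda>x. x $ 2) -` J)"
    then have "x = translation_param f h (vector [x $ 1, x $ 2])"
      by (auto simp: P_def n_inner translation_param_def vec_eq_iff forall_3 f h)
    moreover have "vector [x $ 1, x $ 2] \<in> coordinate_rectangle I J"
      using x by (simp add: coordinate_rectangle_def)
    ultimately show "x \<in> translation_param f h ` coordinate_rectangle I J" by blast
  qed
  then have "openin (top_of_set P) (translation_param f h ` coordinate_rectangle I J)"
    using assms(1,2) by (auto intro!: openin_open_Int open_Int open_vimage_vec_nth)
  ultimately show ?thesis
    unfolding planar_surface_def by blast
qed

lemma induced_metric_translation_param:
  assumes "(f has_field_derivative f') (at (x $ 1))" "(h has_field_derivative h') (at (x $ 2))"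
  defines "d \<equiv> \<lambda>i::2. if i = 1 then f' else h'"
  shows "induced_metric (translation_param f h) x $ i $ j = (if i = j then 1 else 0) + d i * d j"
proof -
  have param: "translation_param f h
      = (\<lambda>x. x $ 1 *\<^sub>R axis 1 1 + x $ 2 *\<^sub>R axis 2 1 + (f (x $ 1) + h (x $ 2)) *\<^sub>R axis 3 1)"
    by (simp add: fun_eq_iff translation_param_def vec_eq_iff forall_3 axis_def)
  have nth: "((\<lambda>x. x $ a) has_derivative (\<lambda>v. v $ a)) (at x)" for a :: 2
    by (rule bounded_linear_imp_has_derivative[OF bounded_linear_vec_nth])
  have der: "(translation_param f h has_derivative
      (\<lambda>v. v $ 1 *\<^sub>R axis 1 1 + v $ 2 *\<^sub>R axis 2 1 + (v $ 1 * f' + v $ 2 * h') *\<^sub>R axis 3 1)) (at x)"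
    unfolding param
    by (intro has_derivative_add has_derivative_scaleR_left nth
        DERIV_compose_FDERIV[where f = f and g = "\<lambda>x. x $ 1", OF assms(1) nth]
        DERIV_compose_FDERIV[where f = h and g = "\<lambda>x. x $ 2", OF assms(2) nth])
  have axis_2: "axis i (1::real) $ j = (if i = j then 1 else 0)" for i j :: 2
    by (simp add: axis_def)
  show ?thesis
    using exhaust_2[of i] exhaust_2[of j]
    by (auto simp: induced_metric_def partial_eqI[OF der] d_def inner_add_left inner_add_right
        inner_axis_axis axis_2)
qed

theorem theorem2:
  fixes I J :: "real set" and f h :: "real \<Rightarrow> real"
  assumes "open I" and "is_interval I" and "I \<noteq> {}"
    and "open J" and "is_interval J" and "J \<noteq> {}"
    and "smooth_on f I" and "smooth_on h J"
  shows "(harmonic_section (coordinate_rectangle I J) (induced_metric (translation_param f h))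
            (coordinate_field 1) \<and>
          harmonic_section (coordinate_rectangle I J) (induced_metric (translation_param f h))
            (coordinate_field 2)
          \<longleftrightarrow>
            (affine_function_on I f \<and> affine_function_on J h)
          \<or> (exponential_profile_on I f \<and> constant_function_on J h)
          \<or> (constant_function_on I f \<and> exponential_profile_on J h))
       \<and> (affine_function_on I f \<and> affine_function_on J h \<longrightarrow>
            planar_surface (translation_param f h ` coordinate_rectangle I J))"
proof -
  define P where "P = (\<lambda>a::2. if a = 1 then f else h)"
  define D where "D = (\<lambda>a::2. if a = 1 then I else J)"
  let ?U = "coordinate_rectangle I J" and ?g = "induced_metric (translation_param f h)"
  interpret translation_surface P D ?g ?U
  proof
    show "x \<in> ?U \<longleftrightarrow> (\<forall>a. x $ a \<in> D a)" for x
      by (simp add: coordinate_rectangle_def D_def forall_2)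
    show "?g x $ i $ j = (if i = j then 1 else 0) + deriv (P i) (x $ i) * deriv (P j) (x $ j)"
      if "x \<in> ?U" for x i j
    proof -
      have "x $ 1 \<in> I" "x $ 2 \<in> J" using that by (simp_all add: coordinate_rectangle_def)
      from induced_metric_translation_param[where x = x,
          OF smooth_on_deriv(2)[OF assms(1,7) this(1)] smooth_on_deriv(2)[OF assms(4,8) this(2)]]
      show ?thesis
        using exhaust_2[of i] exhaust_2[of j] by (auto simp: P_def)
    qed
  qed (use assms in \<open>simp_all add: P_def D_def\<close>)
  have exists_2: "(\<exists>a. R a) \<longleftrightarrow> R 1 \<or> R 2" for R :: "2 \<Rightarrow> bool"
    using forall_2[of "\<lambda>a. \<not> R a"] by blast
  have "harmonic_section ?U ?g (coordinate_field 1) \<and> harmonic_section ?U ?g (coordinate_field 2)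
    \<longleftrightarrow> (affine_function_on I f \<and> affine_function_on J h)
      \<or> (profile_ode f I \<and> constant_function_on J h) \<or> (constant_function_on I f \<and> profile_ode h J)"
    using harmonic_sections_iff
    by (auto simp: forall_2 exists_2 P_def D_def affine_function_on_iff[OF assms(1,2,7)]
        affine_function_on_iff[OF assms(4,5,8)] constant_function_on_iff[OF assms(1,2,7)]
        constant_function_on_iff[OF assms(4,5,8)])
  \<comment> \<open>Affine solutions of the profile equation paired with a constant factor are
    thereby absorbed into the planar case.\<close>
  moreover have "affine_function_on I f" if "constant_function_on I f" for I f
    using that unfolding affine_function_on_def constant_function_on_def
    by (metis add_0 mult_zero_left)
  ultimately show ?thesis
    using affine_or_exponential_if_profile_ode[OF assms(1,2,7)] profile_ode_if_exponential[OF assms(1,2,7)]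
      affine_or_exponential_if_profile_ode[OF assms(4,5,8)] profile_ode_if_exponential[OF assms(4,5,8)]
      planar_surface_if_affine[OF assms(1,4)]
    by blast
qed

end
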